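(* Let $\lambda\ne0$ and $x$ be real numbers and let $n,m\ge1$ be integers. Then $$\mathrm{C.T.}\big|_{\mathbf{z}=0}\ \prod_{j=1}^n\frac{(1-2xz_j+z_j^2)^{-\lambda}}{z_j^{m+n-1}}\prod_{1\le i<j\le n}(z_i-z_j)^2=(-1)^{\binom n2+nm}\,n!\,\det\left(C_{n+i-j}^{-\lambda}(x)\right)_{i,j=1}^m.$$
   Context: $\mathrm{C.T.}|_{\mathbf{z}=0}F(\mathbf{z})$ is the constant term of the Laurent expansion of $F$ at $\mathbf{z}=(z_1,\dots,z_n)=(0,\dots,0)$; $(1-2xz+z^2)^{-\lambda}$ is expanded as the power series in $z$ with value $1$ at $z=0$. For $\lambda\neq0$ the ultraspherical polynomials $C_n^\lambda$ are defined by the generating function $(1-2xz+z^2)^{-\lambda}=\sum_{n=0}^\infty C_n^\lambda(x)z^n$, and $C_n^\lambda=0$ for $n<0$. *)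

theory Defs
  imports
    "HOL-Complex_Analysis.Laurent_Convergence"
    "Jordan_Normal_Form.Determinant"
begin

text \<open>
  Points and exponent vectors in \<open>n\<close> variables are functions on \<open>nat\<close> of which only
  the values at \<open>1, \<dots>, n\<close> matter; exponent vectors are made extensional so that each one
  is a single summation index. Since \<open>has_sum\<close> is unconditional, hence absolute, convergence,
  a function on a punctured polydisc has at most one such expansion (average over the torus
  \<open>\<bar>z\<^sub>j\<bar> = \<rho>\<close>), so the description operator in the constant term below picks a
  unique value whenever an expansion exists.
\<close>

definition laurent_expansion_at_0 ::
    "nat \<Rightarrow> ((nat \<Rightarrow> complex) \<Rightarrow> complex) \<Rightarrow> ((nat \<Rightarrow> int) \<Rightarrow> complex) \<Rightarrow> bool" where
  "laurent_expansion_at_0 n F a \<longleftrightarrow>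
     (\<exists>r>0. \<forall>z. (\<forall>j\<in>{1..n}. 0 < norm (z j) \<and> norm (z j) < r) \<longrightarrow>
        ((\<lambda>k. a k * (\<Prod>j=1..n. z j powi k j)) has_sum F z) (PiE {1..n} (\<lambda>_. UNIV)))"

definition constant_term :: "nat \<Rightarrow> ((nat \<Rightarrow> complex) \<Rightarrow> complex) \<Rightarrow> complex" where
  "constant_term n F =
     (THE c. \<exists>a. laurent_expansion_at_0 n F a \<and> c = a (\<lambda>j\<in>{1..n}. 0))"

text \<open>
  Coefficients of \<open>(1 - 2 x z + z\<^sup>2) powr (- lam)\<close> as a formal power series in \<open>z\<close>:
  \<open>fps_binomial (- lam)\<close> is \<open>(1 + X) powr (- lam)\<close>.
\<close>

definition ultraspherical :: "real \<Rightarrow> int \<Rightarrow> real \<Rightarrow> real" where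
  "ultraspherical lam k x =
     (if k < 0 then 0
      else fps_nth (fps_binomial (- lam) oo (fps_X\<^sup>2 - fps_const (2 * x) * fps_X)) (nat k))"

lemma ultraspherical_generating_function:
  "(\<lambda>z. (1 - 2 * complex_of_real x * z + z\<^sup>2) powr (- complex_of_real lam))
     has_fps_expansion Abs_fps (\<lambda>k. complex_of_real (ultraspherical lam (int k) x))"
proof -
  define G where "G = (fps_X\<^sup>2 - fps_const (2 * x) * fps_X :: real fps)"
  define H where "H = (fps_X\<^sup>2 - fps_const (2 * complex_of_real x) * fps_X)"
  have nth: "fps_nth H k = complex_of_real (fps_nth G k)" for k
    by (simp add: G_def H_def)
  have pow: "fps_nth (H ^ i) k = complex_of_real (fps_nth (G ^ i) k)" for i k
    by (induction i arbitrary: k) (simp_all add: fps_mult_nth nth)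
  have bin: "(complex_of_real a gchoose i) = complex_of_real (a gchoose i)" for a i
    by (simp add: gbinomial_prod_rev)
  have "((\<lambda>w. (1 + w) powr (- complex_of_real lam)) \<circ> (\<lambda>z. z ^ 2 - 2 * complex_of_real x * z))
          has_fps_expansion (fps_binomial (- complex_of_real lam) oo H)"
    unfolding H_def by (intro fps_expansion_intros) simp
  moreover have "fps_binomial (- complex_of_real lam) oo H =
      Abs_fps (\<lambda>k. complex_of_real (ultraspherical lam (int k) x))"
    using bin[of "- lam"]
    by (simp add: fps_eq_iff ultraspherical_def fps_compose_nth pow flip: G_def)
  ultimately show ?thesis
    by (simp add: o_def algebra_simps)
qed

end

theory Submission
  imports Defs "HOL-Library.Real_Mod"
begin

text \<open>
  Writing the squared Vandermonde product as a double sum over permutations makes the integrand a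
  finite sum of products of one-variable Laurent series, whose constant term is \<open>n!\<close> times
  a Hankel determinant in the ultraspherical polynomials. Reversing its rows gives a Toeplitz
  determinant of size \<open>n\<close>. Since the generating functions for \<open>\<lambda>\<close> and
  \<open>-\<lambda>\<close> are mutually inverse, the corresponding lower triangular Toeplitz matrices
  are inverse to each other, and Jacobi's complementary minor identity (as in the duality of the two
  Jacobi-Trudi formulas) turns it into a determinant of size \<open>m\<close>.
\<close>

section \<open>Determinant identities: row reversal, Vandermonde, Toeplitz duality, double sums over
  permutations\<close>

definition reversal_mat :: "nat \<Rightarrow> 'a :: comm_ring_1 mat" where
  "reversal_mat n = mat n n (\<lambda>(i, j). of_bool (i + j = n - 1))"

lemma reversal_mat_carrier [simp]: "reversal_mat n \<in> carrier_mat n n"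
  by (simp add: reversal_mat_def)

text \<open>Moving the first column to the end costs \<open>(- 1) ^ n\<close> and leaves the smaller
  reversal matrix beside a single 1; the exponents add up by
  \<open>n + (n choose 2) = (Suc n choose 2)\<close>.\<close>

lemma det_reversal_mat: "det (reversal_mat n :: 'a :: idom mat) = (- 1) ^ (n choose 2)"
proof (induction n)
  case 0
  show ?case by (simp add: numeral_2_eq_2)
next
  case (Suc n)
  have "det (reversal_mat (n + 1) :: 'a mat) = (- 1) ^ (n * 1) *
      det (mat (n + 1) (n + 1) (\<lambda>(i, j). (reversal_mat (n + 1) :: 'a mat) $$
        (i, if j < n then j + 1 else j - n)))"
    by (rule det_swap_cols) simp
  also have "mat (n + 1) (n + 1) (\<lambda>(i, j). (reversal_mat (n + 1) :: 'a mat) $$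
        (i, if j < n then j + 1 else j - n)) =
      four_block_mat (reversal_mat n) (0\<^sub>m n 1) (0\<^sub>m 1 n) (1\<^sub>m 1)"
    by (rule eq_matI) (auto simp: reversal_mat_def of_bool_def)
  also have "det \<dots> = det (reversal_mat n :: 'a mat) * det (1\<^sub>m 1 :: 'a mat)"
    by (rule det_four_block_mat_lower_left_zero[where n = n and m = 1]) simp_all
  finally show ?case
    using Suc.IH by (simp add: power_add numeral_2_eq_2)
qed

text \<open>Serves to turn a Hankel determinant, with indices depending on \<open>i + j\<close>,
  into a Toeplitz one, with indices depending on \<open>i - j\<close>.\<close>

lemma det_reverse_rows:
  fixes A :: "'a :: idom mat"
  assumes A: "A \<in> carrier_mat n n"
  shows "det (mat n n (\<lambda>(i, j). A $$ (n - 1 - i, j))) = (- 1) ^ (n choose 2) * det A"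
proof -
  have "mat n n (\<lambda>(i, j). A $$ (n - 1 - i, j)) = reversal_mat n * A"
  proof (rule eq_matI)
    fix i j assume "i < dim_row (reversal_mat n * A)" "j < dim_col (reversal_mat n * A)"
    then have ij: "i < n" "j < n"
      using A by (auto simp: reversal_mat_def)
    have "(reversal_mat n * A) $$ (i, j) = (\<Sum>k<n. of_bool (i + k = n - 1) * A $$ (k, j))"
      using A ij by (auto simp: reversal_mat_def scalar_prod_def lessThan_atLeast0 intro!: sum.cong)
    also have "\<dots> = (\<Sum>k<n. if k = n - 1 - i then A $$ (k, j) else 0)"
      using ij by (intro sum.cong) auto
    also have "\<dots> = A $$ (n - 1 - i, j)"
      using ij by (subst sum.delta) auto
    finally show "mat n n (\<lambda>(i, j). A $$ (n - 1 - i, j)) $$ (i, j) = (reversal_mat n * A) $$ (i, j)"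
      using ij by simp
  qed (use A in \<open>auto simp: reversal_mat_def\<close>)
  then show ?thesis
    using A by (simp add: det_mult[of _ n] det_reversal_mat)
qed

lemma det_vandermonde:
  fixes y :: "nat \<Rightarrow> 'a :: idom"
  shows "det (mat n n (\<lambda>(i, j). y i ^ j)) = (\<Prod>j<n. \<Prod>i<j. y j - y i)"
proof -
  \<comment> \<open>Pass to the Newton basis \<open>p j\<close>: the change of basis is unitriangular, and the
    matrix of the values \<open>p j (y i)\<close> is lower triangular.\<close>
  define p where "p j = (\<Prod>i<j. [:- y i, 1:])" for j
  have monic: "degree (p j) = j \<and> coeff (p j) j = 1" for j
  proof (induction j)
    case (Suc j)
    have p_Suc: "p (Suc j) = p j * [:- y j, 1:]"
      by (simp add: p_def mult.commute)
    have "lead_coeff (p (Suc j)) = lead_coeff (p j) * lead_coeff [:- y j, 1:]"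
      unfolding p_Suc by (rule lead_coeff_mult)
    moreover have "degree (p (Suc j)) = degree (p j) + degree [:- y j, 1:]"
      unfolding p_Suc using Suc.IH by (intro degree_mult_eq) auto
    ultimately show ?case
      using Suc.IH by simp
  qed (simp add: p_def)
  define U where "U = mat n n (\<lambda>(i, j). coeff (p j) i)"
  define L where "L = mat n n (\<lambda>(i, j). poly (p j) (y i))"
  define V where "V = mat n n (\<lambda>(i, j). y i ^ j)"
  have carrier: "U \<in> carrier_mat n n" "L \<in> carrier_mat n n" "V \<in> carrier_mat n n"
    by (simp_all add: U_def L_def V_def)
  have "V * U = L"
  proof (rule eq_matI)
    fix i j assume "i < dim_row L" "j < dim_col L"
    then have ij: "i < n" "j < n" by (auto simp: L_def)
    have "poly (p j) (y i) = (\<Sum>k\<le>j. coeff (p j) k * y i ^ k)"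
      using monic[of j] by (simp add: poly_altdef)
    also have "\<dots> = (\<Sum>k<n. coeff (p j) k * y i ^ k)"
      using ij monic[of j] by (intro sum.mono_neutral_left) (auto simp: coeff_eq_0)
    finally show "(V * U) $$ (i, j) = L $$ (i, j)"
      using ij by (simp add: V_def U_def L_def scalar_prod_def lessThan_atLeast0 mult.commute)
  qed (auto simp: V_def U_def L_def)
  moreover have "det U = 1"
  proof -
    have "upper_triangular U"
      using monic by (auto simp: upper_triangular_def U_def coeff_eq_0)
    then have "det U = prod_list (diag_mat U)"
      using carrier(1) by (rule det_upper_triangular)
    also have "\<dots> = 1"
      using monic by (auto simp: U_def prod_list_diag_prod intro!: prod.neutral)
    finally show ?thesis .
  qed
  moreover have "det L = (\<Prod>j<n. \<Prod>i<j. y j - y i)"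
  proof -
    have "L $$ (i, j) = 0" if "i < j" "j < n" for i j
      using that by (auto simp: L_def p_def poly_prod)
    then have "det L = prod_list (diag_mat L)"
      using carrier(2) by (rule det_lower_triangular)
    also have "\<dots> = (\<Prod>j<n. \<Prod>i<j. y j - y i)"
      by (auto simp: L_def prod_list_diag_prod p_def poly_prod lessThan_atLeast0)
    finally show ?thesis .
  qed
  ultimately show ?thesis
    using det_mult[OF carrier(3,1)] by (simp add: V_def)
qed

lemma det_toeplitz_dual:
  fixes c g :: "int \<Rightarrow> 'a :: idom"
  assumes c_neg: "\<And>k. k < 0 \<Longrightarrow> c k = 0" and g_neg: "\<And>k. k < 0 \<Longrightarrow> g k = 0"
    and c_0: "c 0 = 1"
    and conv: "\<And>k. (\<Sum>i\<le>k. c (int i) * g (int k - int i)) = of_bool (k = 0)"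
  shows "det (mat n n (\<lambda>(i, j). c (int m + int i - int j))) =
    (- 1) ^ (n * m) * det (mat m m (\<lambda>(i, j). g (int n + int i - int j)))"
proof -
  \<comment> \<open>\<open>Q\<close> consists of the first \<open>m\<close> columns of the inverse of \<open>A\<close> and
    the first \<open>n\<close> unit vectors, so both \<open>Q\<close> (after a column swap) and \<open>A * Q\<close> are
    block triangular, with the two minors as diagonal blocks.\<close>
  define N where "N = m + n"
  define A where "A = mat N N (\<lambda>(i, j). c (int i - int j))"
  define A1 where "A1 = mat m n (\<lambda>(i, j). c (int i - int j))"
  define A3 where "A3 = mat n n (\<lambda>(i, j). c (int m + int i - int j))"
  define B1 where "B1 = mat n m (\<lambda>(i, j). g (int i - int j))"
  define B3 where "B3 = mat m m (\<lambda>(i, j). g (int n + int i - int j))"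
  define Q where "Q = mat N N (\<lambda>(i, j). if j < m then g (int i - int j) else of_bool (i = j - m))"
  have carrier: "A \<in> carrier_mat N N" "Q \<in> carrier_mat N N"
    by (simp_all add: A_def Q_def)
  \<comment> \<open>Entries of the product of the two lower triangular Toeplitz matrices: only
    \<open>j \<le> k \<le> i\<close> contributes, and \<open>t = i - k\<close> turns the sum into
    the convolution \<open>conv\<close>.\<close>
  have AB: "(\<Sum>k<N. c (int i - int k) * g (int k - int j)) = of_bool (i = j)" if "i < N" for i j
  proof (cases "j \<le> i")
    case True
    have "(\<Sum>k<N. c (int i - int k) * g (int k - int j)) =
        (\<Sum>k\<in>{j..i}. c (int i - int k) * g (int k - int j))"
      using that by (intro sum.mono_neutral_right) (auto simp: c_neg g_neg)
    also have "\<dots> = (\<Sum>t\<le>i - j. c (int t) * g (int (i - j) - int t))"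
      using True
      by (intro sum.reindex_bij_witness[of _ "\<lambda>t. i - t" "\<lambda>k. i - k"]) (auto simp: of_nat_diff algebra_simps)
    also have "\<dots> = of_bool (i = j)"
      unfolding conv using True by auto
    finally show ?thesis .
  next
    case False
    then have "c (int i - int k) * g (int k - int j) = 0" for k
      by (cases "k \<le> i") (auto simp: c_neg g_neg)
    then have "(\<Sum>k<N. c (int i - int k) * g (int k - int j)) = 0"
      by (intro sum.neutral) blast
    with False show ?thesis by simp
  qed
  have "det A = prod_list (diag_mat A)"
    by (rule det_lower_triangular[OF _ carrier(1)]) (simp add: A_def c_neg)
  then have det_A: "det A = 1"
    by (simp add: A_def prod_list_diag_prod c_0)
  \<comment> \<open>The inverse columns in \<open>Q\<close> give identity columns. The unit vectors
    select the first \<open>n\<close> columns of \<open>A\<close>, whose last \<open>n\<close> rows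
    form \<open>A3\<close>.\<close>
  have AQ: "A * Q = four_block_mat (1\<^sub>m m) A1 (0\<^sub>m n m) A3"
  proof (rule eq_matI)
    fix i j
    assume "i < dim_row (four_block_mat (1\<^sub>m m) A1 (0\<^sub>m n m) A3)"
      and "j < dim_col (four_block_mat (1\<^sub>m m) A1 (0\<^sub>m n m) A3)"
    then have ij: "i < N" "j < N"
      by (auto simp: N_def A3_def)
    have AQ_nth: "(A * Q) $$ (i, j) =
        (\<Sum>k<N. c (int i - int k) * (if j < m then g (int k - int j) else of_bool (k = j - m)))"
      using ij by (simp add: A_def Q_def scalar_prod_def lessThan_atLeast0)
    show "(A * Q) $$ (i, j) = four_block_mat (1\<^sub>m m) A1 (0\<^sub>m n m) A3 $$ (i, j)"
    proof (cases "j < m")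
      case True
      then show ?thesis
        using ij AB[OF ij(1), of j] by (auto simp: AQ_nth N_def A1_def A3_def of_bool_def)
    next
      case False
      then have "(A * Q) $$ (i, j) = (\<Sum>k<N. if k = j - m then c (int i - int k) else 0)"
        unfolding AQ_nth by (intro sum.cong) auto
      also have "\<dots> = c (int i - int (j - m))"
        using ij by (subst sum.delta) auto
      finally show ?thesis
        using ij False by (auto simp: N_def A1_def A3_def)
    qed
  qed (auto simp: A_def Q_def N_def A3_def)
  have "det A3 = det (1\<^sub>m m :: 'a mat) * det A3"
    by simp
  also have "\<dots> = det (A * Q)"
    unfolding AQ by (rule det_four_block_mat_lower_left_zero[where n = m and m = n, symmetric]) (simp_all add: A1_def A3_def)
  also have "\<dots> = det Q"
    using det_mult[OF carrier] det_A by simp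
  also have "\<dots> = (- 1) ^ (n * m) * det (four_block_mat (1\<^sub>m n) B1 (0\<^sub>m m n) B3)"
  proof -
    have N: "N = n + m" by (simp add: N_def)
    \<comment> \<open>With the unit vectors moved to the front, the last \<open>m\<close> rows of
      the inverse columns form \<open>B3\<close>.\<close>
    have "mat (n + m) (n + m) (\<lambda>(i, j). Q $$ (i, if j < n then j + m else j - n)) =
        four_block_mat (1\<^sub>m n) B1 (0\<^sub>m m n) B3"
      by (rule eq_matI) (auto simp: Q_def N B1_def B3_def)
    then show ?thesis
      using det_swap_cols[of Q n m] carrier(2) N by simp
  qed
  also have "det (four_block_mat (1\<^sub>m n) B1 (0\<^sub>m m n) B3) = det (1\<^sub>m n :: 'a mat) * det B3"
    by (rule det_four_block_mat_lower_left_zero[where n = n and m = m]) (simp_all add: B1_def B3_def)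
  finally show ?thesis
    by (simp add: A3_def B3_def)
qed

text \<open>For fixed \<open>p\<close> the sum over \<open>q\<close> is the determinant with rows
  permuted by \<open>p\<close>, up to \<open>signof p\<close>. The two signs cancel, so each of the
  \<open>n!\<close> choices of \<open>p\<close> contributes the same determinant.\<close>

lemma sum_permutations_det_rows:
  fixes H :: "nat \<Rightarrow> nat \<Rightarrow> 'a :: comm_ring_1"
  shows "(\<Sum>p | p permutes {0..<n}. \<Sum>q | q permutes {0..<n}.
            signof p * signof q * (\<Prod>i=0..<n. H (p i) (q i))) =
          of_nat (fact n) * det (mat n n (\<lambda>(i, j). H i j))"
proof -
  define A where "A = mat n n (\<lambda>(i, j). H i j)"
  have A: "A \<in> carrier_mat n n"
    by (simp add: A_def)
  have "(\<Sum>q | q permutes {0..<n}. signof p * signof q * (\<Prod>i=0..<n. H (p i) (q i))) = det A"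
    if p: "p permutes {0..<n}" for p
  proof -
    have "(\<Sum>q | q permutes {0..<n}. signof p * signof q * (\<Prod>i=0..<n. H (p i) (q i))) =
        signof p * det (mat n n (\<lambda>(i, j). A $$ (p i, j)))"
      using permutes_in_image[OF p] permutes_in_image[of _ "{0..<n}"]
      by (subst det_def'[of _ n])
         (auto simp: A_def sum_distrib_left mult.assoc intro!: sum.cong prod.cong arg_cong2[of _ _ _ _ "(*)"])
    also have "\<dots> = signof p * (signof p * det A)"
      by (simp add: det_permute_rows[OF A p])
    also have "\<dots> = det A"
      by (simp add: sign_def)
    finally show ?thesis .
  qed
  then show ?thesis
    by (simp add: A_def card_permutations)
qed

section \<open>Uniqueness of Laurent expansions at 0\<close>

text \<open>Some finite \<open>F\<close> carries the whole absolute sum up to half of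
  \<open>norm (g k0)\<close>. If the weights vanish on \<open>E\<close> apart from
  \<open>k0\<close>, the tail outside \<open>E\<close> must sum to \<open>- g k0\<close>, yet its
  norm is at most half of \<open>norm (g k0)\<close>.\<close>

lemma has_sum_isolating_weights_imp_zero:
  fixes g :: "'i \<Rightarrow> complex"
  assumes summable: "g summable_on P" and k0: "k0 \<in> P"
    and weights: "\<And>E. finite E \<Longrightarrow> E \<subseteq> P \<Longrightarrow>
      \<exists>s. (\<forall>k. norm (s k) \<le> 1) \<and> s k0 = 1 \<and> (\<forall>k\<in>E - {k0}. s k = 0) \<and>
          ((\<lambda>k. g k * s k) has_sum 0) P"
  shows "g k0 = 0"
proof (rule ccontr)
  assume "g k0 \<noteq> 0"
  define T where "T = infsum (\<lambda>k. norm (g k)) P"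
  have norm_summable: "(\<lambda>k. norm (g k)) summable_on P"
    using summable by (simp add: summable_on_iff_abs_summable_on_complex)
  then have T: "((\<lambda>k. norm (g k)) has_sum T) P"
    by (simp add: T_def)
  have "norm (g k0) / 2 > 0"
    using \<open>g k0 \<noteq> 0\<close> by simp
  from has_sum_finite_approximation[OF T this] obtain F where F: "finite F" "F \<subseteq> P"
    "dist (\<Sum>k\<in>F. norm (g k)) T \<le> norm (g k0) / 2"
    by blast
  define E where "E = insert k0 F"
  have E: "finite E" "E \<subseteq> P" "k0 \<in> E"
    using F k0 by (auto simp: E_def)
  from weights[OF E(1,2)] obtain s where s: "\<And>k. norm (s k) \<le> 1" "s k0 = 1"
    "\<And>k. k \<in> E - {k0} \<Longrightarrow> s k = 0" "((\<lambda>k. g k * s k) has_sum 0) P"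
    by blast
  have "(\<Sum>k\<in>E. g k * s k) = (\<Sum>k\<in>{k0}. g k * s k)"
    using E s(3) by (intro sum.mono_neutral_right) auto
  then have "((\<lambda>k. g k * s k) has_sum g k0) E"
    using E(1) s(2) by (intro has_sum_finiteI) auto
  then have "((\<lambda>k. g k * s k) has_sum (0 - g k0)) (P - E)"
    by (rule has_sum_Diff[OF s(4) _ E(2)])
  moreover have "((\<lambda>k. norm (g k)) has_sum (T - (\<Sum>k\<in>E. norm (g k)))) (P - E)"
    by (rule has_sum_Diff[OF T _ E(2)]) (use E(1) in simp)
  moreover have "norm (g k * s k) \<le> norm (g k)" for k
    using s(1)[of k] by (simp add: norm_mult mult_left_le)
  ultimately have "norm (0 - g k0) \<le> T - (\<Sum>k\<in>E. norm (g k))"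
    by (rule norm_infsum_le)
  moreover have "(\<Sum>k\<in>F. norm (g k)) \<le> (\<Sum>k\<in>E. norm (g k))"
    using E(1) by (intro sum_mono2) (auto simp: E_def)
  ultimately show False
    using F(3) \<open>norm (g k0) / 2 > 0\<close>
    by (simp only: dist_real_def diff_0 norm_minus_cancel)
qed

text \<open>A geometric sum whose ratio is an \<open>N\<close>-th root of unity, equal to 1 exactly
  when \<open>N\<close> divides \<open>d\<close>.\<close>

lemma sum_cis_powers:
  fixes d :: int and N :: nat
  assumes "N > 0"
  shows "(\<Sum>t<N. cis (2 * pi * of_int d / N) ^ t) = (if int N dvd d then of_nat N else 0)"
proof (cases "int N dvd d")
  case True
  then obtain e where "d = int N * e" by blast
  with assms have "2 * pi * of_int d / N = 2 * pi * of_int e" by simp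
  with True show ?thesis by simp
next
  case False
  have "cis (2 * pi * of_int d / N) \<noteq> 1"
  proof
    assume "cis (2 * pi * of_int d / N) = 1"
    then obtain e :: int where "2 * pi * of_int d / N = of_int e * (2 * pi)"
      unfolding cis_eq_1_iff by blast
    then have "real_of_int d = real_of_int (int N * e)"
      using assms by (simp add: field_simps)
    then have "d = int N * e"
      by (simp only: of_int_eq_iff)
    with False show False by simp
  qed
  moreover have "cis (2 * pi * of_int d / N) ^ N = 1"
    using assms by (simp add: Complex.DeMoivre)
  ultimately show ?thesis
    using False by (simp add: geometric_sum)
qed

lemma has_sum_sum:
  fixes f :: "'i \<Rightarrow> 'k \<Rightarrow> 'a :: topological_comm_monoid_add"
  assumes "\<And>i. i \<in> I \<Longrightarrow> (f i has_sum S i) A"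
  shows "((\<lambda>k. \<Sum>i\<in>I. f i k) has_sum (\<Sum>i\<in>I. S i)) A"
  using assms by (induction I rule: infinite_finite_induct) (simp_all add: has_sum_add)

text \<open>
  Averaging over the \<open>N\<close>-th roots of unity in each variable kills all exponents not congruent to
  \<open>k0\<close> modulo \<open>N\<close>; for large \<open>N\<close> these include any prescribed finite set of
  exponents other than \<open>k0\<close>, and the remaining tail is arbitrarily small.
\<close>

lemma laurent_expansion_at_0_unique:
  assumes a: "laurent_expansion_at_0 n F a" and b: "laurent_expansion_at_0 n F b"
    and k0: "k0 \<in> PiE {1..n} (\<lambda>_. UNIV)"
  shows "a k0 = b k0"
proof -
  define P where "P = PiE {1..n} (\<lambda>_. UNIV :: int set)"
  define c where "c k = a k - b k" for k
  obtain ra where ra: "ra > 0" "\<And>z. (\<forall>j\<in>{1..n}. 0 < norm (z j) \<and> norm (z j) < ra) \<Longrightarrow>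
      ((\<lambda>k. a k * (\<Prod>j=1..n. z j powi k j)) has_sum F z) P"
    using a unfolding laurent_expansion_at_0_def P_def by blast
  obtain rb where rb: "rb > 0" "\<And>z. (\<forall>j\<in>{1..n}. 0 < norm (z j) \<and> norm (z j) < rb) \<Longrightarrow>
      ((\<lambda>k. b k * (\<Prod>j=1..n. z j powi k j)) has_sum F z) P"
    using b unfolding laurent_expansion_at_0_def P_def by blast
  define r where "r = min ra rb / 2"
  have r: "r > 0" "r < ra" "r < rb"
    using ra(1) rb(1) by (auto simp: r_def min_def)
  have on_torus: "((\<lambda>k. c k * (\<Prod>j=1..n. z j powi k j)) has_sum 0) P"
    if "\<And>j. norm (z j) = r" for z
    using has_sum_add[OF ra(2)[of z] has_sum_uminusI[OF rb(2)[of z]]] that r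
    by (simp add: c_def algebra_simps)
  \<comment> \<open>Terms of the difference at the torus point with all coordinates
    \<open>r\<close>; at other torus points they change only by phases.\<close>
  define g where "g k = c k * (\<Prod>j=1..n. complex_of_real r powi k j)" for k
  have summable: "g summable_on P"
    using on_torus[of "\<lambda>_. complex_of_real r"] r by (auto simp: g_def[abs_def] intro: has_sum_imp_summable)
  have weights: "\<exists>s. (\<forall>k. norm (s k) \<le> 1) \<and> s k0 = 1 \<and> (\<forall>k\<in>E - {k0}. s k = 0) \<and>
          ((\<lambda>k. g k * s k) has_sum 0) P" if E: "finite E" "E \<subseteq> P" for E
  proof -
    \<comment> \<open>Larger than every \<open>\<bar>k j - k0 j\<bar>\<close> with \<open>k\<close>
      in \<open>E\<close>, so that \<open>N\<close> divides no nonzero difference of this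
      kind.\<close>
    define N where "N = Suc (\<Sum>k\<in>E. \<Sum>j=1..n. nat \<bar>k j - k0 j\<bar>)"
    have N_bound: "nat \<bar>k j - k0 j\<bar> < N" if "k \<in> E" "j \<in> {1..n}" for k j
    proof -
      have "nat \<bar>k j - k0 j\<bar> \<le> (\<Sum>j=1..n. nat \<bar>k j - k0 j\<bar>)"
        by (rule member_le_sum) (use that in auto)
      also have "\<dots> \<le> (\<Sum>k\<in>E. \<Sum>j=1..n. nat \<bar>k j - k0 j\<bar>)"
        by (rule member_le_sum[of k E "\<lambda>k. \<Sum>j=1..n. nat \<bar>k j - k0 j\<bar>"]) (use that E in auto)
      finally show ?thesis by (simp add: N_def)
    qed
    have "N > 0" by (simp add: N_def)
    define s :: "(nat \<Rightarrow> int) \<Rightarrow> complex"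
      where "s k = (\<Prod>j=1..n. if int N dvd k j - k0 j then 1 else 0)" for k
    define I where "I = PiE {1..n} (\<lambda>_. {..<N})"
    define w where "w k j = cis (2 * pi * of_int (k j - k0 j) / N)" for k j
    define z where "z i j = r * cis (2 * pi * real (i j) / N)" for i :: "nat \<Rightarrow> nat" and j
    have average: "(\<Sum>i\<in>I. \<Prod>j=1..n. w k j ^ i j) = of_nat N ^ n * s k" for k
    proof -
      have "(\<Sum>i\<in>I. \<Prod>j=1..n. w k j ^ i j) = (\<Prod>j=1..n. \<Sum>t<N. w k j ^ t)"
        unfolding I_def by (rule prod_sum_PiE[symmetric]) auto
      also have "\<dots> = (\<Prod>j=1..n. of_nat N * (if int N dvd k j - k0 j then 1 else 0))"
        unfolding w_def sum_cis_powers[OF \<open>N > 0\<close>] by (intro prod.cong) auto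
      finally show ?thesis by (simp add: s_def prod.distrib)
    qed
    \<comment> \<open>Cancels the phase of the monomial with exponent \<open>k0\<close> at
      \<open>z i\<close>, so that averaging over \<open>i\<close> picks out the residue class of
      \<open>k0\<close>.\<close>
    define v where "v i = (\<Prod>j=1..n. cis (- (2 * pi * real (i j) * of_int (k0 j) / N)))"
      for i :: "nat \<Rightarrow> nat"
    have term_eq: "v i * (c k * (\<Prod>j=1..n. z i j powi k j)) = g k * (\<Prod>j=1..n. w k j ^ i j)" for i k
    proof -
      have "cis (- (2 * pi * real (i j) * of_int (k0 j) / N)) * z i j powi k j =
          complex_of_real r powi k j * w k j ^ i j" for j
        by (simp add: z_def w_def power_int_mult_distrib cis_power_int Complex.DeMoivre cis_mult
              mult.left_commute diff_divide_distrib ring_distribs add_divide_distrib mult_ac)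
      then show ?thesis
        unfolding v_def g_def
        by (simp add: mult.left_commute mult.assoc flip: prod.distrib)
    qed
    have "((\<lambda>k. v i * (c k * (\<Prod>j=1..n. z i j powi k j))) has_sum v i * 0) P" for i
      by (intro has_sum_cmult_right on_torus) (use r in \<open>simp add: z_def norm_mult\<close>)
    then have "((\<lambda>k. \<Sum>i\<in>I. g k * (\<Prod>j=1..n. w k j ^ i j)) has_sum (\<Sum>i\<in>I. 0)) P"
      by (intro has_sum_sum) (simp only: term_eq mult_zero_right)
    then have "((\<lambda>k. g k * (of_nat N ^ n * s k)) has_sum 0) P"
      by (simp only: average sum_distrib_left[symmetric] sum.neutral_const)
    from has_sum_cmult_right[OF this, of "1 / of_nat N ^ n"]
    have "((\<lambda>k. g k * s k) has_sum 0) P"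
      using \<open>N > 0\<close> by simp
    moreover have "norm (s k) \<le> 1" for k
      unfolding s_def prod_norm[symmetric] by (intro prod_le_1) auto
    moreover have "s k0 = 1"
      by (simp add: s_def)
    moreover have "s k = 0" if k: "k \<in> E - {k0}" for k
    proof -
      have "k \<in> P" "k0 \<in> P"
        using k E k0 by (auto simp: P_def)
      then obtain j where j: "j \<in> {1..n}" "k j \<noteq> k0 j"
        using k PiE_ext[of k "{1..n}" "\<lambda>_. UNIV" k0] unfolding P_def by blast
      have "\<not> int N dvd k j - k0 j"
        using zdvd_imp_le[of "int N" "\<bar>k j - k0 j\<bar>"] N_bound[of k j] j k by auto
      then show ?thesis
        using j unfolding s_def by (intro prod_zero) auto
    qed
    ultimately show ?thesis by blast
  qed
  have "g k0 = 0"
    using summable k0 unfolding P_def[symmetric]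
    by (rule has_sum_isolating_weights_imp_zero) (rule weights)
  then show ?thesis
    using r by (simp add: g_def c_def)
qed

text \<open>Uniqueness resolves the description operator, so exhibiting one expansion suffices to
  evaluate the constant term.\<close>

lemma constant_term_eqI:
  assumes "laurent_expansion_at_0 n F a"
  shows "constant_term n F = a (\<lambda>j\<in>{1..n}. 0)"
  unfolding constant_term_def
proof (rule the_equality)
  show "\<exists>b. laurent_expansion_at_0 n F b \<and> a (\<lambda>j\<in>{1..n}. 0) = b (\<lambda>j\<in>{1..n}. 0)"
    using assms by blast
next
  fix c assume "\<exists>b. laurent_expansion_at_0 n F b \<and> c = b (\<lambda>j\<in>{1..n}. 0)"
  then show "c = a (\<lambda>j\<in>{1..n}. 0)"
    using laurent_expansion_at_0_unique[OF assms] by force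
qed

section \<open>Laurent expansion of the integrand and its constant term\<close>

text \<open>Complex sums converge unconditionally only if they converge absolutely, so the product
  can be multiplied out. Countability of \<open>'k\<close> serves the theorem on absolute
  summability over \<open>PiE\<close>.\<close>

lemma has_sum_prod_PiE:
  fixes f :: "'i \<Rightarrow> 'k :: countable \<Rightarrow> complex"
  assumes "finite A" and f: "\<And>x. x \<in> A \<Longrightarrow> (f x has_sum S x) (B x)"
  shows "((\<lambda>k. \<Prod>x\<in>A. f x (k x)) has_sum (\<Prod>x\<in>A. S x)) (PiE A B)"
proof -
  have summable: "Infinite_Sum.abs_summable_on (f x) (B x)" if "x \<in> A" for x
    using f[OF that] summable_on_iff_abs_summable_on_complex has_sum_imp_summable by blast
  have "Infinite_Sum.abs_summable_on (\<lambda>k. \<Prod>x\<in>A. f x (k x)) (PiE A B)"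
    using summable \<open>finite A\<close>
    unfolding abs_summable_equivalent by (intro abs_summable_on_prod_PiE) auto
  then have "(\<lambda>k. \<Prod>x\<in>A. f x (k x)) summable_on PiE A B"
    by (rule abs_summable_summable)
  moreover have "infsum (\<lambda>k. \<Prod>x\<in>A. f x (k x)) (PiE A B) = (\<Prod>x\<in>A. S x)"
    using \<open>finite A\<close> summable f
    by (subst infsum_prod_PiE_abs) (auto intro!: prod.cong infsumI)
  ultimately show ?thesis
    by (simp add: has_sum_iff)
qed

text \<open>The radius \<open>r\<close> is fixed before the shift \<open>s\<close>, so that one
  radius serves all pairs of permutations later. Zero coefficients at negative indices let the sum
  run over all integers.\<close>

lemma has_fps_expansion_imp_has_sum_powi:
  fixes f :: "complex \<Rightarrow> complex"
  assumes "f has_fps_expansion F"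
  obtains r where "r > 0"
    "\<And>z s. \<lbrakk>0 < norm z; norm z < r\<rbrakk> \<Longrightarrow>
       ((\<lambda>k. (if k + s < 0 then 0 else fps_nth F (nat (k + s))) * z powi k)
          has_sum f z * z powi (- s)) UNIV"
proof -
  have radius: "fps_conv_radius F > 0" and ev: "eventually (\<lambda>z. eval_fps F z = f z) (nhds 0)"
    using assms by (auto simp: has_fps_expansion_def)
  from ev obtain d where d: "d > 0" "\<And>z. norm z < d \<Longrightarrow> eval_fps F z = f z"
    by (auto simp: eventually_nhds_metric)
  from radius obtain R where R: "0 < ereal R" "ereal R < fps_conv_radius F"
    using ereal_dense2 by blast
  show thesis
  proof (rule that)
    show "min d R > 0"
      using d R by simp
    fix z :: complex and s :: int
    assume z: "0 < norm z" "norm z < min d R"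
    define h where "h t = int t - s" for t
    define C where "C k = (if k + s < 0 then 0 else fps_nth F (nat (k + s)))" for k
    have conv: "ereal (norm z) < fps_conv_radius F"
      using z(2) R(2) by (metis ereal_less_eq(3) le_less_trans less_imp_le min_less_iff_conj)
    have "(\<lambda>t. fps_nth F t * z ^ t) sums f z"
      using conv summable_fps[OF conv] d(2)[of z] z(2) by (auto simp: eval_fps_def sums_iff)
    with norm_summable_fps[OF conv] have "((\<lambda>t. fps_nth F t * z ^ t) has_sum f z) UNIV"
      by (rule norm_summable_imp_has_sum)
    then have "((\<lambda>t. fps_nth F t * z ^ t * z powi (- s)) has_sum f z * z powi (- s)) UNIV"
      by (rule has_sum_cmult_left)
    also have "(\<lambda>t. fps_nth F t * z ^ t * z powi (- s)) = (\<lambda>k. C k * z powi k) \<circ> h"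
      using z(1) by (auto simp: fun_eq_iff C_def h_def power_int_diff power_int_minus field_simps)
    finally have "((\<lambda>k. C k * z powi k) has_sum f z * z powi (- s)) (range h)"
      by (subst has_sum_reindex) (auto simp: h_def inj_on_def o_def)
    \<comment> \<open>The integers missed by \<open>h\<close> are those with
      \<open>k + s < 0\<close>, where \<open>C\<close> vanishes.\<close>
    also have "?this \<longleftrightarrow> ((\<lambda>k. C k * z powi k) has_sum f z * z powi (- s)) UNIV"
    proof (rule has_sum_cong_neutral)
      fix k assume "k \<in> UNIV - range h"
      then have "k \<noteq> h (nat (k + s))" by blast
      then show "C k * z powi k = 0"
        by (auto simp: C_def h_def)
    qed auto
    finally show "((\<lambda>k. (if k + s < 0 then 0 else fps_nth F (nat (k + s))) * z powi k)
        has_sum f z * z powi (- s)) UNIV"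
      by (simp add: C_def)
  qed
qed

text \<open>A pair \<open>p\<close>, \<open>q\<close> of Vandermonde terms puts \<open>z j\<close>
  to the power \<open>p (j - 1) + q (j - 1)\<close>, so its constant term takes one coefficient of
  \<open>F\<close>, at \<open>M\<close> minus that power, from each variable.\<close>

lemma constant_term_vandermonde_squared:
  fixes f :: "complex \<Rightarrow> complex"
  assumes "f has_fps_expansion F"
  shows "constant_term n (\<lambda>z. (\<Prod>j=1..n. f (z j) / z j ^ M) * (\<Prod>j=1..n. \<Prod>i=1..<j. (z i - z j)\<^sup>2)) =
    fact n * det (mat n n (\<lambda>(i, j). if int M - int i - int j < 0 then 0
                                     else fps_nth F (nat (int M - int i - int j))))"
proof -
  define C where "C k = (if k < 0 then 0 else fps_nth F (nat k))" for k
  define D where "D = (\<lambda>z :: nat \<Rightarrow> complex. \<Prod>j=1..n. \<Prod>i=1..<j. (z i - z j)\<^sup>2)"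
  define S where "S = {p. p permutes {0..<n}}"
  \<comment> \<open>The factor in \<open>z j\<close> becomes
    \<open>f (z j) * z j powi (- e p q j)\<close>. Variables are numbered from 1 but permutations
    act on \<open>{0..<n}\<close>, hence \<open>j - 1\<close>.\<close>
  define e where "e p q j = int M - int (p (j - 1)) - int (q (j - 1))" for p q :: "nat \<Rightarrow> nat" and j
  define a where "a k = (\<Sum>p\<in>S. \<Sum>q\<in>S. signof p * signof q * (\<Prod>j=1..n. C (k j + e p q j)))" for k
  obtain r where r: "r > 0" "\<And>z s. \<lbrakk>0 < norm z; norm z < r\<rbrakk> \<Longrightarrow>
      ((\<lambda>k. C (k + s) * z powi k) has_sum f z * z powi (- s)) UNIV"
    unfolding C_def by (rule has_fps_expansion_imp_has_sum_powi[OF assms]) blast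
  have D_eq: "D z = (\<Sum>p\<in>S. \<Sum>q\<in>S. signof p * signof q * (\<Prod>j=1..n. z j ^ p (j - 1) * z j ^ q (j - 1)))" for z
  proof -
    \<comment> \<open>The square allows each difference to be reversed to the orientation used in
      \<open>det_vandermonde\<close>.\<close>
    have shift: "(\<Prod>i=Suc 0..<Suc j. (z i - z (Suc j))\<^sup>2) = (\<Prod>i<j. z (Suc j) - z (Suc i))\<^sup>2" for j
      unfolding prod.shift_bounds_Suc_ivl lessThan_atLeast0 prod_power_distrib
      by (intro prod.cong refl power2_commute)
    have "D z = (\<Prod>j<n. \<Prod>i<j. z (Suc j) - z (Suc i))\<^sup>2"
      by (simp only: D_def One_nat_def prod.atLeast1_atMost_eq shift prod_power_distrib)
    also have "\<dots> = (det (mat n n (\<lambda>(i, j). z (Suc i) ^ j)))\<^sup>2"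
      by (simp add: det_vandermonde)
    also have "det (mat n n (\<lambda>(i, j). z (Suc i) ^ j)) = (\<Sum>p\<in>S. signof p * (\<Prod>j=1..n. z j ^ p (j - 1)))"
    proof -
      have "(\<Prod>i=0..<n. mat n n (\<lambda>(i, j). z (Suc i) ^ j) $$ (i, p i)) = (\<Prod>j=1..n. z j ^ p (j - 1))"
        if "p \<in> S" for p
        using that permutes_in_image[of p "{0..<n}"]
        by (auto simp: S_def prod.atLeast1_atMost_eq lessThan_atLeast0 intro!: prod.cong)
      then show ?thesis
        by (subst det_def'[of _ n]) (auto simp: S_def)
    qed
    finally show ?thesis
      by (simp add: power2_eq_square sum_product prod.distrib mult_ac)
  qed
  have "laurent_expansion_at_0 n (\<lambda>z. (\<Prod>j=1..n. f (z j) / z j ^ M) * D z) a"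
    unfolding laurent_expansion_at_0_def
  proof (intro exI[of _ r] conjI allI impI)
    fix z :: "nat \<Rightarrow> complex"
    assume z: "\<forall>j\<in>{1..n}. 0 < norm (z j) \<and> norm (z j) < r"
    have "((\<lambda>k. \<Sum>p\<in>S. \<Sum>q\<in>S. signof p * signof q * (\<Prod>j=1..n. C (k j + e p q j) * z j powi k j)) has_sum
        (\<Sum>p\<in>S. \<Sum>q\<in>S. signof p * signof q * (\<Prod>j=1..n. f (z j) * z j powi (- e p q j))))
        (PiE {1..n} (\<lambda>_. UNIV))"
      using z r(2) by (intro has_sum_sum has_sum_cmult_right has_sum_prod_PiE) auto
    moreover have "(\<Sum>p\<in>S. \<Sum>q\<in>S. signof p * signof q * (\<Prod>j=1..n. C (k j + e p q j) * z j powi k j)) =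
        a k * (\<Prod>j=1..n. z j powi k j)" for k
      by (simp add: a_def sum_distrib_right prod.distrib mult.assoc)
    moreover have "(\<Sum>p\<in>S. \<Sum>q\<in>S. signof p * signof q * (\<Prod>j=1..n. f (z j) * z j powi (- e p q j))) =
        (\<Prod>j=1..n. f (z j) / z j ^ M) * D z"
    proof -
      have "f (z j) * z j powi (- e p q j) = f (z j) / z j ^ M * (z j ^ p (j - 1) * z j ^ q (j - 1))"
        if "j \<in> {1..n}" for p q j
        using that z by (auto simp: e_def power_int_diff power_int_add field_simps)
      then have "(\<Prod>j=1..n. f (z j) * z j powi (- e p q j)) =
          (\<Prod>j=1..n. f (z j) / z j ^ M) * (\<Prod>j=1..n. z j ^ p (j - 1) * z j ^ q (j - 1))" for p q
        unfolding prod.distrib[symmetric] by (intro prod.cong) auto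
      then show ?thesis
        unfolding D_eq by (simp add: sum_distrib_left mult.left_commute)
    qed
    ultimately show "((\<lambda>k. a k * (\<Prod>j=1..n. z j powi k j)) has_sum
        (\<Prod>j=1..n. f (z j) / z j ^ M) * D z) (PiE {1..n} (\<lambda>_. UNIV))"
      by simp
  qed (use r in auto)
  then have "constant_term n (\<lambda>z. (\<Prod>j=1..n. f (z j) / z j ^ M) * D z) = a (\<lambda>j\<in>{1..n}. 0)"
    by (rule constant_term_eqI)
  also have "\<dots> = (\<Sum>p\<in>S. \<Sum>q\<in>S. signof p * signof q *
      (\<Prod>i=0..<n. C (int M - int (p i) - int (q i))))"
    unfolding a_def by (simp add: prod.atLeast1_atMost_eq e_def lessThan_atLeast0)
  also have "\<dots> = of_nat (fact n) * det (mat n n (\<lambda>(i, j). C (int M - int i - int j)))"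
    unfolding S_def by (rule sum_permutations_det_rows)
  finally show ?thesis
    by (simp add: C_def D_def)
qed

section \<open>Ultraspherical coefficients and the final determinant\<close>

lemma ultraspherical_neg [simp]: "k < 0 \<Longrightarrow> ultraspherical lam k x = 0"
  by (simp add: ultraspherical_def)

text \<open>The generating series for \<open>lam\<close> and \<open>- lam\<close> are
  \<open>1 + G\<close> to opposite powers, with product 1; composition respects the product because
  \<open>G\<close> has constant term 0. This is the condition \<open>conv\<close> of
  \<open>det_toeplitz_dual\<close>.\<close>

lemma ultraspherical_convolution:
  "(\<Sum>i\<le>k. ultraspherical lam (int i) x * ultraspherical (- lam) (int k - int i) x) = of_bool (k = 0)"
proof -
  define G where "G = fps_X\<^sup>2 - fps_const (2 * x) * fps_X"
  have "fps_nth G 0 = 0" by (simp add: G_def)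
  then have "(fps_binomial (- lam) oo G) * (fps_binomial lam oo G) = fps_binomial (- lam + lam) oo G"
    by (simp only: fps_compose_mult_distrib fps_binomial_add_mult)
  also have "\<dots> = 1" by simp
  finally have "fps_nth ((fps_binomial (- lam) oo G) * (fps_binomial lam oo G)) k = of_bool (k = 0)"
    by simp
  moreover have "ultraspherical (- lam) (int k - int i) x = fps_nth (fps_binomial lam oo G) (k - i)"
    if "i \<le> k" for i
    using that by (simp add: ultraspherical_def G_def nat_diff_distrib)
  ultimately show ?thesis
    by (simp add: ultraspherical_def fps_mult_nth atLeast0AtMost flip: G_def)
qed

theorem mainTheorem14:
  fixes lam x :: real and n m :: nat
  assumes "lam \<noteq> 0" and "n \<ge> 1" and "m \<ge> 1"
  shows "constant_term n
           (\<lambda>z. (\<Prod>j=1..n. (1 - 2 * complex_of_real x * z j + (z j)\<^sup>2) powr (- complex_of_real lam)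
                           / z j ^ (m + n - 1))
                * (\<Prod>j=1..n. \<Prod>i=1..<j. (z i - z j)\<^sup>2))
         = complex_of_real
             ((-1) ^ ((n choose 2) + n * m) * fact n
              * det (mat m m (\<lambda>(i, j). ultraspherical (- lam) (int n + int i - int j) x)))"
proof -
  interpret of_real_hom: comm_ring_hom complex_of_real
    by unfold_locales auto
  define T where "T = mat n n (\<lambda>(i, j). ultraspherical lam (int m + int i - int j) x)"
  \<comment> \<open>Row \<open>n - 1 - i\<close> of \<open>T\<close> has index
    \<open>m + (n - 1 - i) - j = (m + n - 1) - i - j\<close>. By \<open>n \<ge> 1\<close> the
    natural subtractions are exact, and negative indices give 0 on both sides.\<close>
  have "det (mat n n (\<lambda>(i, j). if int (m + n - 1) - int i - int j < 0 then 0
          else fps_nth (Abs_fps (\<lambda>k. complex_of_real (ultraspherical lam (int k) x)))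
            (nat (int (m + n - 1) - int i - int j)))) =
      det (map_mat complex_of_real (mat n n (\<lambda>(i, j). T $$ (n - 1 - i, j))))"
    (is "det ?H = _")
    using \<open>n \<ge> 1\<close> by (intro arg_cong[of _ _ det] eq_matI) (auto simp: T_def of_nat_diff algebra_simps)
  also have "\<dots> = complex_of_real (det (mat n n (\<lambda>(i, j). T $$ (n - 1 - i, j))))"
    by (rule of_real_hom.hom_det)
  also have "det (mat n n (\<lambda>(i, j). T $$ (n - 1 - i, j))) = (- 1) ^ (n choose 2) * det T"
    by (rule det_reverse_rows) (simp add: T_def)
  \<comment> \<open>Here \<open>c\<close> and \<open>g\<close> are the coefficients for
    \<open>lam\<close> and \<open>- lam\<close>; the closing \<open>simp\<close> settles
    \<open>c 0 = 1\<close>.\<close>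
  also have "det T = (- 1) ^ (n * m) *
      det (mat m m (\<lambda>(i, j). ultraspherical (- lam) (int n + int i - int j) x))"
    unfolding T_def
    by (rule det_toeplitz_dual) (simp_all add: ultraspherical_convolution, simp add: ultraspherical_def)
  finally have det_eq: "det ?H =
      complex_of_real ((- 1) ^ (n choose 2) * ((- 1) ^ (n * m) *
        det (mat m m (\<lambda>(i, j). ultraspherical (- lam) (int n + int i - int j) x))))" .
  show ?thesis
    unfolding constant_term_vandermonde_squared[OF ultraspherical_generating_function] det_eq
    by (simp add: power_add)
qed

end
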